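(* Let $\lambda\in\mathbb R$, $\alpha>0$, $a>0$, $V(x)=\lambda\frac{|x|^2}2$ on $\mathbb R^d$, $\mu_0=\mathcal N(a)$, and let $\rho^0,\rho^\alpha$ be the solutions starting from $\mu_0$ of $$\partial_t\rho-\operatorname{div}(\rho\nabla V)=0\qquad\text{and}\qquad\partial_t\rho-\operatorname{div}(\rho\nabla V)=\frac\alpha2\Delta\rho$$ respectively, namely, for $t\ge 0$, $\rho^0(t)=\mathcal N(ae^{-2\lambda t})$ and $\rho^\alpha(t)=\mathcal N\big(ae^{-2\lambda t}+\alpha\frac{1-e^{-2\lambda t}}{2\lambda}\big)$ if $\lambda\ne0$, and $\rho^0(t)=\mathcal N(a)$, $\rho^\alpha(t)=\mathcal N(a+\alpha t)$ if $\lambda=0$. Then for all $t\ge0$, $$W_2(\rho^0(t),\rho^\alpha(t))=\frac\alpha2\int_0^te^{\lambda(s-t)}\sqrt{\int|\nabla\ln(\rho^\alpha_s)|^2\,d\rho^\alpha_s}\,ds.$$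
   Context: For $s>0$, $\mathcal N(s)$ denotes the centered Gaussian probability measure on $\mathbb R^d$ with density $(2\pi s)^{-d/2}e^{-|x|^2/(2s)}$ (a measure is identified with its density). $W_2$ is the quadratic Wasserstein distance. $\rho^\alpha_s=\rho^\alpha(s)$. *)

theory Defs
  imports "HOL-Analysis.Analysis"
begin

definition gaussian_density :: "real \<Rightarrow> 'a::euclidean_space \<Rightarrow> real" where
  "gaussian_density s x =
     (2 * pi * s) powr (- real DIM('a) / 2) * exp (- (norm x)\<^sup>2 / (2 * s))"

definition density_measure :: "('a::euclidean_space \<Rightarrow> real) \<Rightarrow> 'a measure" where
  "density_measure f = density lborel (\<lambda>x. ennreal (f x))"

definition couplings :: "'a::euclidean_space measure \<Rightarrow> 'a measure \<Rightarrow> ('a \<times> 'a) measure set" where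
  "couplings \<mu> \<nu> =
     {\<gamma>. sets \<gamma> = sets (borel \<Otimes>\<^sub>M borel) \<and> distr \<gamma> borel fst = \<mu> \<and> distr \<gamma> borel snd = \<nu>}"

definition ennreal_sqrt :: "ennreal \<Rightarrow> ennreal" where
  "ennreal_sqrt r = (if r = \<infinity> then \<infinity> else ennreal (sqrt (enn2real r)))"

definition W2 :: "'a::euclidean_space measure \<Rightarrow> 'a measure \<Rightarrow> ennreal" where
  "W2 \<mu> \<nu> = ennreal_sqrt
     (INF \<gamma>\<in>couplings \<mu> \<nu>. \<integral>\<^sup>+ z. ennreal ((dist (fst z) (snd z))\<^sup>2) \<partial>\<gamma>)"

(* Only meaningful at points where f is differentiable. *)
definition grad :: "('a::euclidean_space \<Rightarrow> real) \<Rightarrow> 'a \<Rightarrow> 'a" where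
  "grad f x = (THE D. GDERIV f x :> D)"

definition divergence :: "('a::euclidean_space \<Rightarrow> 'a) \<Rightarrow> 'a \<Rightarrow> real" where
  "divergence F x = (\<Sum>b\<in>Basis. frechet_derivative F (at x) b \<bullet> b)"

definition laplacian :: "('a::euclidean_space \<Rightarrow> real) \<Rightarrow> 'a \<Rightarrow> real" where
  "laplacian f x = divergence (grad f) x"

(* Classical solutions u t x on t \<ge> 0 of
     \<partial>u/\<partial>t - div (u grad V) = (\<alpha>/2) laplacian u,  u = u0 at t = 0
   (one-sided time derivative at t = 0); \<alpha> = 0 is the continuity equation.
   The differentiability conditions exclude junk values of grad and divergence. *)
definition fokker_planck_solution ::
  "('a::euclidean_space \<Rightarrow> real) \<Rightarrow> real \<Rightarrow> ('a \<Rightarrow> real) \<Rightarrow> (real \<Rightarrow> 'a \<Rightarrow> real) \<Rightarrow> bool" where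
  "fokker_planck_solution V \<alpha> u0 u \<longleftrightarrow>
     u 0 = u0 \<and>
     (\<forall>t\<ge>0. \<forall>x.
        V differentiable (at x) \<and>
        u t differentiable (at x) \<and>
        grad (u t) differentiable (at x) \<and>
        (\<lambda>y. u t y *\<^sub>R grad V y) differentiable (at x) \<and>
        (\<exists>D. ((\<lambda>s. u s x) has_real_derivative D) (at t within {0..}) \<and>
             D - divergence (\<lambda>y. u t y *\<^sub>R grad V y) x = \<alpha> / 2 * laplacian (u t) x))"

end

theory Submission
  imports Defs "HOL-Probability.Distributions"
begin

text \<open>The density of variance \<open>\<sigma>\<close> solves the Fokker--Planck equation as soon as
  \<open>\<sigma>' = \<alpha> - 2 \<lambda> \<sigma>\<close>, so everything reduces to this scalar equation.
  The dilation by \<open>c = sqrt (q / p)\<close> transports \<open>N(p)\<close> to \<open>N(q)\<close>, and Young's inequality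
  with weight \<open>c\<close> bounds the cost of any other coupling by second moments; hence
  \<open>W2 = sqrt d |sqrt q - sqrt p|\<close>. On the other side the Fisher information of \<open>N(\<sigma>)\<close> is
  \<open>d / \<sigma>\<close>, and \<open>\<alpha> / 2 * exp (\<lambda> s) / sqrt (\<sigma> s)\<close> is the derivative of
  \<open>exp (\<lambda> s) * sqrt (\<sigma> s)\<close>.\<close>

section \<open>Gradients and divergences\<close>

text \<open>\<open>grad\<close> is a definite description, so uniqueness has to be proved: two
  gradients represent the same derivative, and testing it on their difference makes that difference
  vanish.\<close>

lemma grad_eqI: "GDERIV f x :> D \<Longrightarrow> grad f x = D"
proof -
  assume D: "GDERIV f x :> D"
  have "E = D" if "GDERIV f x :> E" for E
  proof -
    have "(\<lambda>h. h \<bullet> E) = (\<lambda>h. h \<bullet> D)"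
      using D that unfolding gderiv_def by (rule has_derivative_unique[rotated])
    then have "(E - D) \<bullet> E = (E - D) \<bullet> D"
      by (rule fun_cong)
    then have "(E - D) \<bullet> (E - D) = 0"
      by (simp add: inner_diff_right)
    then show ?thesis
      by simp
  qed
  with D show ?thesis
    unfolding grad_def by (intro the_equality)
qed

text \<open>For a centered Gaussian and a quadratic potential, both the drift flux and the gradient
  of the density are a scalar function times the identity field. This one product rule therefore
  serves the transport term and the Laplacian alike.\<close>

lemma divergence_scaleR_id:
  fixes f :: "'a::euclidean_space \<Rightarrow> real"
  assumes "GDERIV f x :> D"
  shows "(\<lambda>y. f y *\<^sub>R y) differentiable (at x)"
    and "divergence (\<lambda>y. f y *\<^sub>R y) x = f x * DIM('a) + x \<bullet> D"
proof -
  have d: "((\<lambda>y. f y *\<^sub>R y) has_derivative (\<lambda>h. f x *\<^sub>R h + (h \<bullet> D) *\<^sub>R x)) (at x)"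
    using has_derivative_scaleR[OF assms[unfolded gderiv_def] has_derivative_ident] by simp
  then show "(\<lambda>y. f y *\<^sub>R y) differentiable (at x)"
    by (auto simp: differentiable_def)
  have "divergence (\<lambda>y. f y *\<^sub>R y) x = (\<Sum>b\<in>Basis. (f x *\<^sub>R b + (b \<bullet> D) *\<^sub>R x) \<bullet> b)"
    by (simp add: divergence_def frechet_derivative_at[OF d, symmetric])
  also have "\<dots> = (\<Sum>b\<in>(Basis::'a set). f x) + (\<Sum>b\<in>Basis. (x \<bullet> b) * (D \<bullet> b))"
    unfolding sum.distrib[symmetric]
    by (intro sum.cong) (auto simp: inner_add_left inner_same_Basis inner_commute[of D])
  also have "\<dots> = f x * DIM('a) + x \<bullet> D"
    by (simp add: euclidean_inner[of x D])
  finally show "divergence (\<lambda>y. f y *\<^sub>R y) x = f x * DIM('a) + x \<bullet> D" .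
qed

lemma GDERIV_norm_power2: "GDERIV (\<lambda>y. (norm y)\<^sup>2) x :> 2 *\<^sub>R x"
  unfolding gderiv_def power2_norm_eq_inner
  by (auto intro!: derivative_eq_intros simp: inner_commute)

section \<open>Derivatives of the Gaussian density in space and in the variance\<close>

lemma gaussian_density_pos: "s > 0 \<Longrightarrow> gaussian_density s x > 0"
  by (simp add: gaussian_density_def)

lemma borel_measurable_gaussian_density [measurable]:
  "gaussian_density s \<in> borel_measurable borel"
  unfolding gaussian_density_def[abs_def] by measurable

lemma GDERIV_gaussian_density:
  assumes "s > 0"
  shows "GDERIV (gaussian_density s) x :> (- gaussian_density s x / s) *\<^sub>R x"
proof -
  \<comment> \<open>The density is viewed as a function of the squared norm, which is smooth at the
    origin as well, unlike the norm itself.\<close>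
  let ?g = "\<lambda>r. (2 * pi * s) powr (- real DIM('a) / 2) * exp (- r / (2 * s))"
  have "DERIV ?g ((norm x)\<^sup>2) :> - ?g ((norm x)\<^sup>2) / (2 * s)"
    using assms by (auto intro!: derivative_eq_intros simp: field_simps)
  from GDERIV_DERIV_compose[OF GDERIV_norm_power2 this]
  show ?thesis
    by (simp add: gaussian_density_def[abs_def])
qed

text \<open>The value is half the spatial Laplacian of the density: the variance plays the role of
  time in the heat equation.\<close>

lemma DERIV_gaussian_density_variance:
  fixes x :: "'a::euclidean_space"
  assumes "s > 0"
  shows "DERIV (\<lambda>s. gaussian_density s x) s :>
    gaussian_density s x * ((norm x)\<^sup>2 / (2 * s\<^sup>2) - DIM('a) / (2 * s))"
proof -
  let ?p = "- real DIM('a) / 2"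
  have 1: "DERIV (\<lambda>s. (2 * pi * s) powr ?p) s :> (2 * pi * s) powr ?p * (?p / s)"
  proof (rule DERIV_cong)
    show "DERIV (\<lambda>s. (2 * pi * s) powr ?p) s :> ?p * (2 * pi * s) powr (?p - of_nat 1) * (2 * pi)"
      using assms by (intro DERIV_fun_powr) (auto intro!: derivative_eq_intros)
    show "?p * (2 * pi * s) powr (?p - of_nat 1) * (2 * pi) = (2 * pi * s) powr ?p * (?p / s)"
      using assms by (simp add: powr_diff)
  qed
  have 2: "DERIV (\<lambda>s. exp (- (norm x)\<^sup>2 / (2 * s))) s :>
      exp (- (norm x)\<^sup>2 / (2 * s)) * ((norm x)\<^sup>2 / (2 * s\<^sup>2))"
    using assms by (auto intro!: derivative_eq_intros simp: field_simps power2_eq_square)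
  show ?thesis
    unfolding gaussian_density_def
    by (rule DERIV_cong[OF DERIV_mult[OF 1 2]]) (simp add: algebra_simps)
qed

lemma grad_ln_gaussian_density:
  assumes "s > 0"
  shows "grad (\<lambda>y. ln (gaussian_density s y)) x = - x /\<^sub>R s"
proof -
  have "GDERIV (\<lambda>y. ln (gaussian_density s y)) x :>
      (1 / gaussian_density s x) *\<^sub>R ((- gaussian_density s x / s) *\<^sub>R x)"
    using gaussian_density_pos[OF assms]
    by (intro GDERIV_DERIV_compose[OF GDERIV_gaussian_density[OF assms]] DERIV_ln_divide)
  then show ?thesis
    using gaussian_density_pos[OF assms, of x] by (simp add: grad_eqI divide_inverse)
qed

section \<open>Gaussian solutions of the Fokker--Planck equation\<close>

text \<open>Write g for the density at time t. The time derivative is \<sigma>' times half the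
  Laplacian of g, and the divergence of the flux is - lam * \<sigma> times that Laplacian. With the
  scalar equation for \<sigma> the terms in lam cancel, leaving \<alpha> / 2 times the Laplacian.
  Keeping \<sigma> abstract covers both flows and the case lam = 0.\<close>

lemma fokker_planck_solution_gaussian:
  fixes V :: "'a::euclidean_space \<Rightarrow> real"
  assumes V: "\<And>x. V x = lam * ((norm x)\<^sup>2 / 2)"
    and u: "\<And>t. t \<ge> 0 \<Longrightarrow> u t = gaussian_density (\<sigma> t)"
    and pos: "\<And>t. t \<ge> 0 \<Longrightarrow> \<sigma> t > 0"
    and ode: "\<And>t. t \<ge> 0 \<Longrightarrow> DERIV \<sigma> t :> \<alpha> - 2 * lam * \<sigma> t"
  shows "fokker_planck_solution V \<alpha> (gaussian_density (\<sigma> 0)) u"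
proof -
  have "GDERIV (\<lambda>x. (lam / 2) * (norm x)\<^sup>2) x :> lam *\<^sub>R x" for x :: 'a
    using GDERIV_mult[OF GDERIV_const GDERIV_norm_power2, of "lam / 2"] by simp
  then have DV: "GDERIV V x :> lam *\<^sub>R x" for x
  proof -
    have "V = (\<lambda>x. (lam / 2) * (norm x)\<^sup>2)"
      using V by auto
    then show ?thesis
      by (simp only: \<open>\<And>x. GDERIV (\<lambda>x. (lam / 2) * (norm x)\<^sup>2) x :> lam *\<^sub>R x\<close>)
  qed
  then have gradV: "grad V = (\<lambda>x. lam *\<^sub>R x)"
    by (auto intro!: grad_eqI)
  have main:
    "u t differentiable (at x) \<and> grad (u t) differentiable (at x) \<and>
     (\<lambda>y. u t y *\<^sub>R grad V y) differentiable (at x) \<and>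
     (\<exists>D. ((\<lambda>s. u s x) has_real_derivative D) (at t within {0..}) \<and>
         D - divergence (\<lambda>y. u t y *\<^sub>R grad V y) x = \<alpha> / 2 * laplacian (u t) x)"
    if t: "t \<ge> 0" for t x
  proof (intro conjI exI)
    let ?s = "\<sigma> t"
    let ?g = "gaussian_density ?s :: 'a \<Rightarrow> real"
    note s = pos[OF t]
    note Dg = GDERIV_gaussian_density[OF s]
    have ut: "u t = ?g"
      using u t by simp
    \<comment> \<open>Both fields are brought to the form (c * g) times the identity, with c = - 1 /
      \<sigma> and c = lam, so that \<open>div\<close> applies to each.\<close>
    have gradu: "grad (u t) = (\<lambda>y. (- (1 / ?s) * ?g y) *\<^sub>R y)"
      using Dg by (auto simp: ut intro!: ext grad_eqI)
    have flux: "(\<lambda>y. u t y *\<^sub>R grad V y) = (\<lambda>y. (lam * ?g y) *\<^sub>R y)"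
      by (simp add: ut gradV mult.commute)
    have Dc: "GDERIV (\<lambda>y. c * ?g y) x :> c *\<^sub>R ((- ?g x / ?s) *\<^sub>R x)" for c
      using GDERIV_mult[OF GDERIV_const Dg] by simp
    note div = divergence_scaleR_id[OF Dc]
    show "u t differentiable (at x)"
      using Dg[of x] by (auto simp: ut gderiv_def differentiable_def)
    show "grad (u t) differentiable (at x)"
      unfolding gradu by (rule div)
    show "(\<lambda>y. u t y *\<^sub>R grad V y) differentiable (at x)"
      unfolding flux by (rule div)
    let ?D = "?g x * ((norm x)\<^sup>2 / (2 * ?s\<^sup>2) - DIM('a) / (2 * ?s)) * (\<alpha> - 2 * lam * ?s)"
    have "DERIV (\<lambda>r. gaussian_density (\<sigma> r) x) t :> ?D"
      using DERIV_chain2[OF DERIV_gaussian_density_variance[OF s] ode[OF t]] .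
    \<comment> \<open>The derivative is two-sided, but \<open>u\<close> is known only for
      nonnegative times, so the restriction to \<open>{0..}\<close> comes before the replacement.
      The radius 1 is arbitrary.\<close>
    then have "((\<lambda>r. gaussian_density (\<sigma> r) x) has_real_derivative ?D) (at t within {0..})"
      by (rule has_field_derivative_at_within)
    then show "((\<lambda>r. u r x) has_real_derivative ?D) (at t within {0..})"
      by (rule has_field_derivative_transform_within[where d = 1]) (use t u in auto)
    show "?D - divergence (\<lambda>y. u t y *\<^sub>R grad V y) x = \<alpha> / 2 * laplacian (u t) x"
      unfolding laplacian_def flux gradu div using s
      by (simp add: power2_norm_eq_inner[symmetric] field_simps power2_eq_square)
  qed
  have "V differentiable (at x)" for x
    using DV[of x] by (auto simp: gderiv_def differentiable_def)
  with main u show ?thesis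
    unfolding fokker_planck_solution_def by simp
qed

section \<open>Second moments of centered Gaussians\<close>

text \<open>This lets integrals over the whole space factor into one-dimensional ones.
  \<open>normal_density\<close> takes the standard deviation, hence \<open>sqrt s\<close>.\<close>

lemma gaussian_density_eq_prod:
  fixes x :: "'a::euclidean_space"
  assumes "s > 0"
  shows "gaussian_density s x = (\<Prod>b\<in>Basis. normal_density 0 (sqrt s) (x \<bullet> b))"
proof -
  have "(\<Prod>b\<in>Basis. normal_density 0 (sqrt s) (x \<bullet> b)) =
      (\<Prod>b\<in>(Basis :: 'a set). (2 * pi * s) powr (- 1 / 2)) *
      (\<Prod>b\<in>Basis. exp (- (x \<bullet> b)\<^sup>2 / (2 * s)))"
    unfolding prod.distrib[symmetric] using assms
    by (intro prod.cong) (auto simp: normal_density_def powr_minus_divide powr_half_sqrt)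
  also have "(\<Prod>b\<in>(Basis :: 'a set). (2 * pi * s) powr (- 1 / 2)) =
      (2 * pi * s) powr (- real DIM('a) / 2)"
    using assms by (simp add: powr_power)
  also have "(\<Prod>b\<in>Basis. exp (- (x \<bullet> b)\<^sup>2 / (2 * s))) = exp (- (norm x)\<^sup>2 / (2 * s))"
    unfolding power2_norm_eq_inner euclidean_inner[of x x]
    by (simp add: exp_sum[symmetric] sum_negf sum_divide_distrib[symmetric] power2_eq_square)
  finally show ?thesis
    by (simp add: gaussian_density_def)
qed

lemma nn_integral_normal_moment_2:
  assumes "s > 0"
  shows "(\<integral>\<^sup>+y. ennreal (y\<^sup>2 * normal_density 0 (sqrt s) y) \<partial>lborel) = ennreal s"
proof -
  have "has_bochner_integral lborel (\<lambda>y. y\<^sup>2 * normal_density 0 (sqrt s) y) s"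
    using normal_moment_even[of "sqrt s" 0 1] assms by (simp add: mult.commute)
  then show ?thesis
    using assms by (subst nn_integral_eq_integral) (auto simp: has_bochner_integral_iff)
qed

lemma nn_integral_gaussian_density_norm2:
  fixes s :: real
  assumes s: "s > 0"
  shows "(\<integral>\<^sup>+x. ennreal ((norm x)\<^sup>2) \<partial>density_measure (gaussian_density s :: 'a::euclidean_space \<Rightarrow> real))
    = ennreal (DIM('a) * s)"
proof -
  let ?n = "normal_density 0 (sqrt s)"
  have n1: "(\<integral>\<^sup>+y. ennreal (?n y) \<partial>lborel) = 1"
    using s by (subst nn_integral_eq_integral) auto
  have coord: "(\<integral>\<^sup>+x. ennreal ((x \<bullet> c)\<^sup>2 * gaussian_density s x) \<partial>lborel) = ennreal s"
    if c: "c \<in> Basis" for c :: 'a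
  proof -
    \<comment> \<open>The square is attached to the direction \<open>c\<close> only, so the product
      consists of one second moment and otherwise total masses equal to 1.\<close>
    let ?f = "\<lambda>b y. ennreal ((if b = c then y\<^sup>2 else 1) * ?n y)"
    have "ennreal ((x \<bullet> c)\<^sup>2 * gaussian_density s x) = (\<Prod>b\<in>Basis. ?f b (x \<bullet> b))" for x
    proof -
      have "(x \<bullet> c)\<^sup>2 = (\<Prod>b\<in>Basis. if b = c then (x \<bullet> b)\<^sup>2 else 1)"
        using c by (simp add: prod.delta)
      then show ?thesis
        using s by (simp add: prod_ennreal gaussian_density_eq_prod prod.distrib)
    qed
    then have "(\<integral>\<^sup>+x. ennreal ((x \<bullet> c)\<^sup>2 * gaussian_density s x) \<partial>lborel) =
        (\<Prod>b\<in>(Basis::'a set). (\<integral>\<^sup>+y. ?f b y \<partial>lborel))"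
      by (simp only:) (rule nn_integral_lborel_prod, auto)
    also have "\<dots> = (\<Prod>b\<in>(Basis::'a set). if b = c then ennreal s else 1)"
      using n1 nn_integral_normal_moment_2[OF s] by (intro prod.cong) auto
    also have "\<dots> = ennreal s"
      using c by (simp add: prod.delta)
    finally show ?thesis .
  qed
  have "(\<integral>\<^sup>+x. ennreal ((norm x)\<^sup>2) \<partial>density_measure (gaussian_density s :: 'a \<Rightarrow> real)) =
     (\<integral>\<^sup>+x. (\<Sum>c\<in>Basis. ennreal (((x::'a) \<bullet> c)\<^sup>2 * gaussian_density s x)) \<partial>lborel)"
    unfolding density_measure_def
  proof (subst nn_integral_density, simp, simp, intro nn_integral_cong)
    fix x :: 'a
    have "(norm x)\<^sup>2 = (\<Sum>c\<in>Basis. (x \<bullet> c)\<^sup>2)"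
      unfolding power2_norm_eq_inner euclidean_inner[of x x] by (simp add: power2_eq_square)
    then show "ennreal (gaussian_density s x) * ennreal ((norm x)\<^sup>2) =
      (\<Sum>c\<in>Basis. ennreal ((x \<bullet> c)\<^sup>2 * gaussian_density s x))"
      using gaussian_density_pos[OF s, of x]
      by (simp add: sum_ennreal ennreal_mult[symmetric] sum_distrib_left sum_nonneg mult.commute)
  qed
  also have "\<dots> = (\<Sum>c\<in>(Basis::'a set). ennreal s)"
    by (subst nn_integral_sum) (auto simp: coord)
  also have "\<dots> = ennreal (DIM('a) * s)"
    using s by (simp add: ennreal_mult ennreal_of_nat_eq_real_of_nat)
  finally show ?thesis .
qed

lemma integral_gaussian_density_norm2:
  fixes s :: real
  assumes "s > 0"
  shows "(LINT x|density_measure (gaussian_density s :: 'a::euclidean_space \<Rightarrow> real). (norm x)\<^sup>2)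
    = DIM('a) * s"
  using nn_integral_gaussian_density_norm2[OF assms, where 'a = 'a] assms
  by (subst integral_eq_nn_integral) (auto simp: density_measure_def)

section \<open>Dilations and the Wasserstein distance between centered Gaussians\<close>

lemma distr_gaussian_density_scaleR:
  assumes "s > 0" "c > 0"
  shows "distr (density_measure (gaussian_density s)) borel (\<lambda>x. c *\<^sub>R x) =
    density_measure (gaussian_density (c\<^sup>2 * s) :: 'a::euclidean_space \<Rightarrow> real)"
proof -
  let ?d = "DIM('a)"
  \<comment> \<open>The summand 0 gives the map the shape required by
    \<open>lborel_affine\<close>.\<close>
  let ?T = "\<lambda>x::'a. 0 + c *\<^sub>R x"
  let ?g = "gaussian_density (c\<^sup>2 * s) :: 'a \<Rightarrow> real"
  \<comment> \<open>The Jacobian of the dilation cancels the change in the normalising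
    constant.\<close>
  have eq: "c ^ ?d * ?g (c *\<^sub>R x) = gaussian_density s x" for x
  proof -
    have "(2 * pi * (c\<^sup>2 * s)) powr (- real ?d / 2) =
        (c powr 2) powr (- real ?d / 2) * (2 * pi * s) powr (- real ?d / 2)"
      using assms by (simp add: powr_mult[symmetric] mult_ac)
    also have "(c powr 2) powr (- real ?d / 2) = inverse (c ^ ?d)"
      using assms by (simp only: powr_powr) (simp add: powr_minus powr_realpow)
    finally show ?thesis
      using assms by (simp add: gaussian_density_def power_mult_distrib)
  qed
  have "density_measure ?g = density (density (distr lborel borel ?T) (\<lambda>_. \<bar>c\<bar> ^ ?d)) (\<lambda>x. ennreal (?g x))"
    using lborel_affine[of c "0::'a"] assms by (simp add: density_measure_def)
  also have "\<dots> = density (distr lborel borel ?T) (\<lambda>x. ennreal (c ^ ?d * ?g x))"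
    using assms gaussian_density_pos[of "c\<^sup>2 * s"]
    by (simp add: density_density_eq ennreal_mult'[symmetric] less_imp_le)
  also have "\<dots> = distr (density lborel (\<lambda>x. ennreal (c ^ ?d * ?g (?T x)))) borel ?T"
    by (rule density_distr) auto
  finally show ?thesis
    by (simp add: eq density_measure_def)
qed

lemma W2_gaussian:
  fixes p q :: real
  assumes p: "p > 0" and q: "q > 0"
  shows "W2 (density_measure (gaussian_density p :: 'a::euclidean_space \<Rightarrow> real))
      (density_measure (gaussian_density q)) = ennreal (sqrt DIM('a) * \<bar>sqrt q - sqrt p\<bar>)"
proof -
  define \<mu> where "\<mu> = density_measure (gaussian_density p :: 'a \<Rightarrow> real)"
  define \<nu> where "\<nu> = density_measure (gaussian_density q :: 'a \<Rightarrow> real)"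
  define c where "c = sqrt q / sqrt p"
  let ?d = "real DIM('a)"
  let ?cost = "\<lambda>\<gamma>. \<integral>\<^sup>+ z. ennreal ((dist (fst z) (snd z))\<^sup>2) \<partial>(\<gamma> :: ('a \<times> 'a) measure)"
  define L where "L = ?d * (sqrt q - sqrt p)\<^sup>2"
  have c: "c > 0" and c2: "c\<^sup>2 * p = q"
    using p q by (auto simp: c_def power_divide)
  \<comment> \<open>Both c * p and q / c equal sqrt p * sqrt q, so the bracket is the cross term of
    the square. This is the form in which integrating Young's inequality delivers the bound.\<close>
  have L_alt: "L = ?d * p + ?d * q - (c * (?d * p) + (?d * q) / c)"
  proof -
    obtain x y where xy: "x > 0" "y > 0" "p = x\<^sup>2" "q = y\<^sup>2"
      using p q by (metis real_sqrt_gt_zero real_sqrt_pow2 less_imp_le)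
    then show ?thesis
      by (simp add: L_def c_def field_simps power2_eq_square)
  qed
  have [simp]: "sets \<mu> = sets borel" "space \<mu> = UNIV" "sets \<nu> = sets borel"
    by (simp_all add: \<mu>_def \<nu>_def density_measure_def)
  note m\<mu> = nn_integral_gaussian_density_norm2[OF p, where 'a = 'a, folded \<mu>_def]
  note m\<nu> = nn_integral_gaussian_density_norm2[OF q, where 'a = 'a, folded \<nu>_def]
  \<comment> \<open>Lower bound: apart from the cost, every term of Young's inequality depends on
    one marginal only, so its integral is the same for all couplings.\<close>
  have "ennreal L \<le> ?cost \<gamma>" if "\<gamma> \<in> couplings \<mu> \<nu>" for \<gamma>
  proof -
    have [measurable_cong]: "sets \<gamma> = sets (borel \<Otimes>\<^sub>M borel)"
      and d1: "distr \<gamma> borel fst = \<mu>" and d2: "distr \<gamma> borel snd = \<nu>"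
      using that by (auto simp: couplings_def)
    have m: "(\<lambda>x::'a. ennreal ((norm x)\<^sup>2)) \<in> borel_measurable borel"
      by measurable
    have I1: "(\<integral>\<^sup>+z. ennreal ((norm (fst z))\<^sup>2) \<partial>\<gamma>) = ennreal (?d * p)"
      using nn_integral_distr[of fst \<gamma> borel "\<lambda>x. ennreal ((norm x)\<^sup>2)", unfolded measurable_distr_eq1, OF _ m] by (simp add: d1 m\<mu>)
    have I2: "(\<integral>\<^sup>+z. ennreal ((norm (snd z))\<^sup>2) \<partial>\<gamma>) = ennreal (?d * q)"
      using nn_integral_distr[of snd \<gamma> borel "\<lambda>x. ennreal ((norm x)\<^sup>2)", unfolded measurable_distr_eq1, OF _ m] by (simp add: d2 m\<nu>)
    \<comment> \<open>Young's inequality \<open>2 x \<bullet> y \<le> c |x|\<^sup>2 + |y|\<^sup>2 / c\<close>, with equality iff \<open>y = c x\<close>,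
      arranged so that all terms are nonnegative and the integrals can stay in \<open>ennreal\<close>.\<close>
    have young: "(norm x)\<^sup>2 + (norm y)\<^sup>2 \<le> (dist x y)\<^sup>2 + (c * (norm x)\<^sup>2 + (norm y)\<^sup>2 / c)"
      for x y :: 'a
    proof -
      have "0 \<le> (norm (c *\<^sub>R x - y))\<^sup>2 / c"
        using c by simp
      also have "\<dots> = c * (norm x)\<^sup>2 + (norm y)\<^sup>2 / c - 2 * (x \<bullet> y)"
        using c by (simp add: power2_norm_eq_inner inner_diff inner_commute field_simps)
      finally show ?thesis
        by (simp add: dist_norm power2_norm_eq_inner inner_diff inner_commute)
    qed
    have "ennreal (?d * p) + ennreal (?d * q) =
        (\<integral>\<^sup>+z. ennreal ((norm (fst z))\<^sup>2) + ennreal ((norm (snd z))\<^sup>2) \<partial>\<gamma>)"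
      by (subst nn_integral_add) (auto simp: I1 I2)
    also have "\<dots> \<le> (\<integral>\<^sup>+z. ennreal ((dist (fst z) (snd z))\<^sup>2) +
        (ennreal c * ennreal ((norm (fst z))\<^sup>2) + ennreal (1 / c) * ennreal ((norm (snd z))\<^sup>2)) \<partial>\<gamma>)"
      using young c
      by (intro nn_integral_mono)
        (simp add: ennreal_mult[symmetric] ennreal_plus[symmetric] del: ennreal_plus)
    also have "\<dots> = ?cost \<gamma> + (ennreal c * ennreal (?d * p) + ennreal (1 / c) * ennreal (?d * q))"
      by (simp add: nn_integral_add nn_integral_cmult I1 I2)
    also have "ennreal c * ennreal (?d * p) + ennreal (1 / c) * ennreal (?d * q) =
        ennreal (c * (?d * p) + (?d * q) / c)"
      using c p q by (simp add: ennreal_mult[symmetric] ennreal_plus[symmetric] del: ennreal_plus)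
    finally have le: "ennreal (?d * p + ?d * q) \<le> ?cost \<gamma> + ennreal (c * (?d * p) + (?d * q) / c)"
      using p q by simp
    show ?thesis
    \<comment> \<open>A finite cost permits the subtraction in the reals; for an infinite cost the
      bound is trivial.\<close>
    proof (cases "?cost \<gamma>")
      case (real r)
      then have "?d * p + ?d * q \<le> r + (c * (?d * p) + (?d * q) / c)"
        using le c p q by (simp add: ennreal_plus[symmetric] del: ennreal_plus)
      then show ?thesis
        using real by (simp add: L_alt ennreal_leI)
    qed simp
  qed
  moreover have "\<exists>\<gamma>\<in>couplings \<mu> \<nu>. ?cost \<gamma> = ennreal L"
  proof
    \<comment> \<open>The coupling is concentrated on the graph of the dilation, which is exactly
      the equality case of Young's inequality.\<close>
    let ?\<gamma> = "distr \<mu> (borel \<Otimes>\<^sub>M borel) (\<lambda>x. (x, c *\<^sub>R x))"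
    have [measurable_cong]: "sets \<mu> = sets borel"
      by simp
    have "distr \<mu> borel (\<lambda>x. c *\<^sub>R x) = \<nu>"
      using distr_gaussian_density_scaleR[OF p c, where 'a = 'a] by (simp add: \<mu>_def \<nu>_def c2)
    moreover have "distr \<mu> borel (\<lambda>x. x) = \<mu>"
      by (rule distr_id2) simp
    ultimately show "?\<gamma> \<in> couplings \<mu> \<nu>"
      by (simp add: couplings_def distr_distr comp_def)
    have "?cost ?\<gamma> = (\<integral>\<^sup>+x. ennreal ((dist x (c *\<^sub>R x))\<^sup>2) \<partial>\<mu>)"
      by (subst nn_integral_distr) auto
    also have "\<dots> = (\<integral>\<^sup>+x. ennreal ((c - 1)\<^sup>2) * ennreal ((norm x)\<^sup>2) \<partial>\<mu>)"
    proof (intro nn_integral_cong)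
      fix x :: 'a
      have "x - c *\<^sub>R x = (1 - c) *\<^sub>R x"
        by (simp add: algebra_simps)
      then show "ennreal ((dist x (c *\<^sub>R x))\<^sup>2) = ennreal ((c - 1)\<^sup>2) * ennreal ((norm x)\<^sup>2)"
        by (simp add: dist_norm power_mult_distrib ennreal_mult[symmetric] power2_commute)
    qed
    also have "\<dots> = ennreal ((c - 1)\<^sup>2) * ennreal (?d * p)"
      by (simp add: nn_integral_cmult m\<mu>)
    also have "\<dots> = ennreal L"
    proof -
      have "sqrt q = c * sqrt p"
        using p by (simp add: c_def)
      then have "L = ?d * ((c - 1)\<^sup>2 * (sqrt p)\<^sup>2)"
        by (simp add: L_def power_mult_distrib[symmetric] algebra_simps)
      then show ?thesis
        using p by (simp add: ennreal_mult[symmetric] mult_ac)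
    qed
    finally show "?cost ?\<gamma> = ennreal L" .
  qed
  ultimately have "(INF \<gamma>\<in>couplings \<mu> \<nu>. ?cost \<gamma>) = ennreal L"
    by (intro antisym INF_greatest) (auto intro: INF_lower2)
  then show ?thesis
    by (simp add: W2_def \<mu>_def[symmetric] \<nu>_def[symmetric] ennreal_sqrt_def L_def real_sqrt_mult)
qed

section \<open>Fisher information and the time integral\<close>

text \<open>The gradient of the log-density is linear, - x / s, so the Fisher information is the
  second moment divided by the square of s.\<close>

lemma sqrt_fisher_information_gaussian:
  assumes "s > 0"
  shows "sqrt (LINT x|density_measure (gaussian_density s :: 'a::euclidean_space \<Rightarrow> real).
      (norm (grad (\<lambda>y. ln (gaussian_density s y)) x))\<^sup>2) = sqrt DIM('a) / sqrt s"
proof -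
  have "(LINT x|density_measure (gaussian_density s :: 'a \<Rightarrow> real).
      (norm (grad (\<lambda>y. ln (gaussian_density s y)) x))\<^sup>2) = DIM('a) * s / s\<^sup>2"
    using assms
    by (simp add: grad_ln_gaussian_density divide_inverse power_mult_distrib power_inverse
        integral_gaussian_density_norm2)
  then show ?thesis
    using assms by (simp add: power2_eq_square real_sqrt_divide)
qed

text \<open>Differentiating the exponential in \<open>?F\<close> produces a term that cancels the -
  2 * lam * \<sigma> part of \<sigma>', so only the \<alpha> part survives. The constant
  \<open>k\<close> will be the square root of the dimension.\<close>

lemma integral_exp_sqrt_variance:
  fixes \<sigma> :: "real \<Rightarrow> real"
  assumes t: "t \<ge> 0"
    and pos: "\<And>s. s \<ge> 0 \<Longrightarrow> \<sigma> s > 0"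
    and ode: "\<And>s. s \<ge> 0 \<Longrightarrow> DERIV \<sigma> s :> \<alpha> - 2 * lam * \<sigma> s"
  shows "\<alpha> / 2 * (LBINT s:{0..t}. exp (lam * (s - t)) * (k / sqrt (\<sigma> s))) =
    k * (sqrt (\<sigma> t) - exp (- lam * t) * sqrt (\<sigma> 0))"
proof -
  let ?f = "\<lambda>s. \<alpha> / 2 * (exp (lam * (s - t)) * (k / sqrt (\<sigma> s)))"
  let ?F = "\<lambda>s. k * (exp (lam * (s - t)) * sqrt (\<sigma> s))"
  have "(LBINT s:{0..t}. ?f s) = ?F t - ?F 0"
    unfolding set_lebesgue_integral_def
  proof (rule integral_FTC_atLeastAtMost[OF t])
    fix s assume "0 \<le> s" "s \<le> t"
    note s = pos[OF \<open>0 \<le> s\<close>] ode[OF \<open>0 \<le> s\<close>]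
    have "DERIV (\<lambda>s. sqrt (\<sigma> s)) s :> (inverse (sqrt (\<sigma> s)) / 2) * (\<alpha> - 2 * lam * \<sigma> s)"
      using DERIV_chain2[OF DERIV_real_sqrt[OF s(1)] s(2)] .
    moreover have "DERIV (\<lambda>s. exp (lam * (s - t))) s :> lam * exp (lam * (s - t))"
      by (auto intro!: derivative_eq_intros)
    ultimately have "DERIV ?F s :> k * (lam * exp (lam * (s - t)) * sqrt (\<sigma> s) +
        inverse (sqrt (\<sigma> s)) / 2 * (\<alpha> - 2 * lam * \<sigma> s) * exp (lam * (s - t)))"
      by (intro DERIV_cmult DERIV_mult)
    also have "k * (lam * exp (lam * (s - t)) * sqrt (\<sigma> s) +
        inverse (sqrt (\<sigma> s)) / 2 * (\<alpha> - 2 * lam * \<sigma> s) * exp (lam * (s - t))) = ?f s"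
    proof -
      \<comment> \<open>Writing \<sigma> s as a square removes the roots and leaves an identity of
        rational expressions.\<close>
      obtain r where "r > 0" "\<sigma> s = r\<^sup>2"
        using s(1) by (metis real_sqrt_gt_zero real_sqrt_pow2 less_imp_le)
      then show ?thesis
        by (simp add: field_simps power2_eq_square)
    qed
    finally show "(?F has_vector_derivative ?f s) (at s within {0..t})"
      unfolding has_real_derivative_iff_has_vector_derivative[symmetric]
      by (rule has_field_derivative_at_within)
  next
    have "continuous_on {0..t} \<sigma>"
      using ode by (auto intro!: continuous_at_imp_continuous_on DERIV_isCont)
    moreover have "sqrt (\<sigma> s) \<noteq> 0" if "s \<in> {0..t}" for s
      using pos[of s] that by simp
    ultimately show "continuous_on {0..t} ?f"
      by (intro continuous_intros) auto
  qed
  also have "?F t - ?F 0 = k * (sqrt (\<sigma> t) - exp (- lam * t) * sqrt (\<sigma> 0))"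
    by (simp add: algebra_simps)
  finally show ?thesis
    by (simp only: set_integral_mult_right)
qed

section \<open>The two flows and their distance\<close>

theorem proposition5p5:
  fixes lam \<alpha> a :: real
    and V :: "'a::euclidean_space \<Rightarrow> real"
    and \<rho>0 \<rho>\<alpha> :: "real \<Rightarrow> 'a \<Rightarrow> real"
  assumes "\<alpha> > 0" and "a > 0"
    and V: "\<And>x. V x = lam * ((norm x)\<^sup>2 / 2)"
    and \<rho>0: "\<And>t. t \<ge> 0 \<Longrightarrow> \<rho>0 t =
          gaussian_density (if lam = 0 then a else a * exp (- 2 * lam * t))"
    and \<rho>\<alpha>: "\<And>t. t \<ge> 0 \<Longrightarrow> \<rho>\<alpha> t =
          gaussian_density (if lam = 0 then a + \<alpha> * t
            else a * exp (- 2 * lam * t) + \<alpha> * ((1 - exp (- 2 * lam * t)) / (2 * lam)))"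
  shows "fokker_planck_solution V 0 (gaussian_density a) \<rho>0 \<and>
         fokker_planck_solution V \<alpha> (gaussian_density a) \<rho>\<alpha> \<and>
         (\<forall>t\<ge>0. W2 (density_measure (\<rho>0 t)) (density_measure (\<rho>\<alpha> t)) =
            ennreal (\<alpha> / 2 * (LBINT s:{0..t}. exp (lam * (s - t)) *
              sqrt (LINT x|density_measure (\<rho>\<alpha> s). (norm (grad (\<lambda>y. ln (\<rho>\<alpha> s y)) x))\<^sup>2))))"
proof -
  define \<sigma>0 where "\<sigma>0 = (\<lambda>t. if lam = 0 then a else a * exp (- 2 * lam * t))"
  define \<sigma> where "\<sigma> = (\<lambda>t. if lam = 0 then a + \<alpha> * t
      else a * exp (- 2 * lam * t) + \<alpha> * ((1 - exp (- 2 * lam * t)) / (2 * lam)))"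
  have u0: "\<rho>0 t = gaussian_density (\<sigma>0 t)" and u: "\<rho>\<alpha> t = gaussian_density (\<sigma> t)"
    if "t \<ge> 0" for t
    using \<rho>0[OF that] \<rho>\<alpha>[OF that] by (simp_all add: \<sigma>0_def \<sigma>_def)
  \<comment> \<open>For \<sigma>0 the case lam = 0 is absorbed by exp 0 = 1. For \<sigma> it is a
    genuine case, as division by zero would yield 0 in place of t.\<close>
  have \<sigma>0_eq: "\<sigma>0 t = exp (- 2 * lam * t) * a" for t
    by (simp add: \<sigma>0_def)
  have pos0: "\<sigma>0 t > 0" for t
    using \<open>a > 0\<close> by (simp add: \<sigma>0_def)
  \<comment> \<open>Diffusion only increases the variance. This gives positivity of \<sigma> and
    later removes the absolute value in the distance.\<close>
  have ge: "\<sigma> t \<ge> \<sigma>0 t" if "t \<ge> 0" for t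
  proof (cases "lam = 0")
    case False
    \<comment> \<open>Numerator and denominator cannot have opposite signs, whatever the sign of
      lam.\<close>
    have "(1 - exp (- 2 * lam * t)) / (2 * lam) \<ge> 0"
    proof (cases "lam > 0")
      case True
      then show ?thesis using that by simp
    next
      case neg: False
      then have "1 \<le> exp (- 2 * lam * t)"
        using that by (simp add: mult_nonpos_nonneg)
      with neg show ?thesis by (intro divide_nonpos_nonpos) auto
    qed
    then have "\<alpha> * ((1 - exp (- 2 * lam * t)) / (2 * lam)) \<ge> 0"
      using \<open>\<alpha> > 0\<close> by (intro mult_nonneg_nonneg) auto
    with False show ?thesis
      by (simp add: \<sigma>_def \<sigma>0_def)
  qed (use that \<open>\<alpha> > 0\<close> in \<open>simp add: \<sigma>_def \<sigma>0_def\<close>)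
  have pos: "\<sigma> t > 0" if "t \<ge> 0" for t
    using ge[OF that] pos0[of t] by linarith
  have ode0: "DERIV \<sigma>0 t :> 0 - 2 * lam * \<sigma>0 t" for t
    unfolding \<sigma>0_eq[abs_def] by (auto intro!: derivative_eq_intros)
  have ode: "DERIV \<sigma> t :> \<alpha> - 2 * lam * \<sigma> t" for t
    by (cases "lam = 0") (auto simp: \<sigma>_def intro!: derivative_eq_intros simp: field_simps)
  have init: "\<sigma>0 0 = a" "\<sigma> 0 = a"
    by (simp_all add: \<sigma>0_def \<sigma>_def)
  have "W2 (density_measure (\<rho>0 t)) (density_measure (\<rho>\<alpha> t)) =
      ennreal (\<alpha> / 2 * (LBINT s:{0..t}. exp (lam * (s - t)) *
        sqrt (LINT x|density_measure (\<rho>\<alpha> s). (norm (grad (\<lambda>y. ln (\<rho>\<alpha> s y)) x))\<^sup>2)))"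
    if t: "t \<ge> 0" for t
  proof -
    have "(LBINT s:{0..t}. exp (lam * (s - t)) *
        sqrt (LINT x|density_measure (\<rho>\<alpha> s). (norm (grad (\<lambda>y. ln (\<rho>\<alpha> s y)) x))\<^sup>2)) =
        (LBINT s:{0..t}. exp (lam * (s - t)) * (sqrt DIM('a) / sqrt (\<sigma> s)))"
      by (rule set_lebesgue_integral_cong)
        (auto simp: u pos sqrt_fisher_information_gaussian)
    \<comment> \<open>The boundary term at time 0 of the integral is thus the standard deviation of
      the noiseless flow at time t, which is how \<sigma>0 enters the right-hand side.\<close>
    moreover have "exp (- lam * t) * sqrt a = sqrt (\<sigma>0 t)"
    proof -
      have "\<sigma>0 t = (exp (- lam * t))\<^sup>2 * a"
        by (simp add: \<sigma>0_eq exp_double[symmetric] mult_ac)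
      then show ?thesis
        by (simp add: real_sqrt_mult)
    qed
    ultimately have "\<alpha> / 2 * (LBINT s:{0..t}. exp (lam * (s - t)) *
        sqrt (LINT x|density_measure (\<rho>\<alpha> s). (norm (grad (\<lambda>y. ln (\<rho>\<alpha> s y)) x))\<^sup>2)) =
        sqrt DIM('a) * (sqrt (\<sigma> t) - sqrt (\<sigma>0 t))"
      using integral_exp_sqrt_variance[of t \<sigma> \<alpha> lam "sqrt DIM('a)", OF t pos ode] init by simp
    moreover have "\<bar>sqrt (\<sigma> t) - sqrt (\<sigma>0 t)\<bar> = sqrt (\<sigma> t) - sqrt (\<sigma>0 t)"
      using ge[OF t] by simp
    ultimately show ?thesis
      by (simp only: u0[OF t] u[OF t] W2_gaussian[OF pos0 pos[OF t]])
  qed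
  moreover have "fokker_planck_solution V 0 (gaussian_density a) \<rho>0"
    using fokker_planck_solution_gaussian[of V lam \<rho>0 \<sigma>0 0, OF V u0 pos0 ode0] init by simp
  moreover have "fokker_planck_solution V \<alpha> (gaussian_density a) \<rho>\<alpha>"
    using fokker_planck_solution_gaussian[of V lam \<rho>\<alpha> \<sigma> \<alpha>, OF V u pos ode] init by simp
  ultimately show ?thesis
    by blast
qed

end
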